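(* For every integer $n\ge1$, $$\left\lfloor\left(\sum_{k=n}^\infty\frac{(-1)^k}{B_{2k+1}}\right)^{-1}\right\rfloor=\begin{cases}B_{2n+1}+B_{2n-1}&\text{if $n$ is even},\\ -(B_{2n+1}+B_{2n-1}+1)&\text{if $n$ is odd}.\end{cases}$$
   Context: The balancing numbers are defined by $B_0=0$, $B_1=1$, $B_n=6B_{n-1}-B_{n-2}$ for $n\ge 2$. $\lfloor x\rfloor$ denotes the floor of a real number $x$. *)

theory Defs
  imports Complex_Main
begin

fun balancing :: "nat \<Rightarrow> int" where
  "balancing 0 = 0"
| "balancing (Suc 0) = 1"
| "balancing (Suc (Suc n)) = 6 * balancing (Suc n) - balancing n"

end

theory Submission
  imports Defs
begin

text \<open>
  Put \<open>C k = B (2 k + 1)\<close> and \<open>D k = C k + C (k - 1)\<close>. Since \<open>C (k + 1) = 34 C k - C (k - 1)\<close> and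
  \<open>C (k + 1) C (k - 1) = (C k)^2 - 36\<close>, one gets
  \<open>1 / D k + 1 / D (k + 1) = 1 / C k + e k\<close> with \<open>e k = 1 / (C k ((C k)^2 - 1))\<close>.
  Telescoping, \<open>1 / D n\<close> exceeds the alternating sum of the \<open>1 / C (n + j)\<close> by the alternating sum
  of the \<open>e (n + j)\<close>, which lies strictly above 0 and at most at \<open>e n < 1 / D n - 1 / (D n + 1)\<close>.
\<close>

definition odd_balancing :: "nat \<Rightarrow> real" where
  "odd_balancing k = real_of_int (balancing (2 * k + 1))"

lemma odd_balancing_0: "odd_balancing 0 = 1"
  by (simp add: odd_balancing_def)

lemma odd_balancing_1: "odd_balancing (Suc 0) = 35"
  by (simp add: odd_balancing_def numeral_eq_Suc)

text \<open>Doubling the step turns the coefficient 6 into 6^2 - 2 = 34.\<close>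

lemma odd_balancing_Suc_Suc:
  "odd_balancing (Suc (Suc k)) = 34 * odd_balancing (Suc k) - odd_balancing k"
  by (simp add: odd_balancing_def)

text \<open>The recurrence leaves the difference of the product and the square unchanged; its
  initial value is 1189 * 1 - 35^2 = -36.\<close>

lemma odd_balancing_cassini:
  "odd_balancing (Suc (Suc k)) * odd_balancing k = odd_balancing (Suc k) ^ 2 - 36"
proof (induction k)
  case 0
  show ?case
    by (simp add: odd_balancing_Suc_Suc odd_balancing_0 odd_balancing_1)
next
  case (Suc k)
  then show ?case
    by (simp add: odd_balancing_Suc_Suc power2_eq_square algebra_simps)
qed

text \<open>Both bounds go through one induction: positivity turns the factor 33 into monotonicity,
  and 34 times a term minus a smaller one is at least 33 times that term.\<close>

lemma odd_balancing_growth: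
  "1 \<le> odd_balancing k \<and> 33 * odd_balancing k \<le> odd_balancing (Suc k)"
proof (induction k)
  case 0
  show ?case by (simp add: odd_balancing_0 odd_balancing_1)
next
  case (Suc k)
  then show ?case using odd_balancing_Suc_Suc[of k] by linarith
qed

lemma odd_balancing_ge_1: "1 \<le> odd_balancing k"
  using odd_balancing_growth by blast

lemma odd_balancing_less_Suc: "odd_balancing k < odd_balancing (Suc k)"
  using odd_balancing_growth[of k] by linarith

lemma odd_balancing_Suc_ge_33: "33 \<le> odd_balancing (Suc k)"
  using odd_balancing_growth[of k] by linarith

text \<open>Crude, but enough for divergence to infinity.\<close>

lemma odd_balancing_ge_index: "real k \<le> odd_balancing k"
proof (induction k)
  case 0
  show ?case by (simp add: odd_balancing_0)
next
  case (Suc k)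
  then show ?case using odd_balancing_growth[of k] by simp
qed

lemma filterlim_odd_balancing: "filterlim odd_balancing at_top sequentially"
  by (rule filterlim_at_top_mono[OF filterlim_real_sequentially])
    (simp add: odd_balancing_ge_index)

text \<open>At \<open>k = 0\<close> the denominator vanishes and division yields the default 0, so
  the facts below speak of \<open>Suc k\<close> only.\<close>

definition odd_balancing_error :: "nat \<Rightarrow> real" where
  "odd_balancing_error k = 1 / (odd_balancing k * (odd_balancing k ^ 2 - 1))"

lemma reciprocal_pair_sum:
  "1 / (odd_balancing (Suc k) + odd_balancing k)
     + 1 / (odd_balancing (Suc (Suc k)) + odd_balancing (Suc k))
   = 1 / odd_balancing (Suc k) + odd_balancing_error (Suc k)"
proof -
  define x y z where "x = odd_balancing k" and "y = odd_balancing (Suc k)"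
    and "z = odd_balancing (Suc (Suc k))"
  have pos: "1 \<le> x" "33 \<le> y" "1 \<le> z"
    unfolding x_def y_def z_def
    by (rule odd_balancing_ge_1 odd_balancing_Suc_ge_33)+
  have y2: "0 < y ^ 2 - 1"
    using one_less_power[of y 2] pos by simp
  have z: "z + x = 34 * y" and zx: "z * x = y ^ 2 - 36"
    unfolding x_def y_def z_def
    using odd_balancing_Suc_Suc[of k] odd_balancing_cassini[of k] by simp_all
  \<comment> \<open>Sum and product of the outer terms are known in \<open>y\<close>, so only
    \<open>y\<close> survives: the coefficients 1 + 34 + 1 give 36, matching the Cassini constant.
    The numerator below is also 36 \<open>y\<close>, and 36 cancels.\<close>
  have "(y + x) * (z + y) = y ^ 2 + y * (z + x) + z * x"
    by (simp add: algebra_simps power2_eq_square)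
  then have prod: "(y + x) * (z + y) = 36 * (y ^ 2 - 1)"
    by (simp add: z zx power2_eq_square)
  have "1 / (y + x) + 1 / (z + y) = ((z + x) + 2 * y) / ((y + x) * (z + y))"
    using pos by (simp add: add_frac_eq algebra_simps)
  also have "\<dots> = y / (y ^ 2 - 1)"
    unfolding prod z using y2 by (simp add: field_simps)
  also have "\<dots> = 1 / y + 1 / (y * (y ^ 2 - 1))"
  proof -
    \<comment> \<open>An opaque \<open>w\<close> keeps the simplifier from expanding
      \<open>y ^ 2 - 1\<close>; afterwards \<open>w + 1\<close> is \<open>y ^ 2\<close>.\<close>
    have "1 / y + 1 / (y * w) = (w + 1) / (y * w)" if "w \<noteq> 0" for w
      using that pos by (simp add: field_simps)
    from this[of "y ^ 2 - 1"] show ?thesis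
      using y2 pos by (simp add: power2_eq_square)
  qed
  finally show ?thesis
    by (simp add: x_def y_def z_def odd_balancing_error_def)
qed

lemma odd_balancing_error_pos: "0 < odd_balancing_error (Suc k)"
proof -
  have "1 < odd_balancing (Suc k)"
    using odd_balancing_Suc_ge_33[of k] by simp
  then show ?thesis
    using one_less_power[of "odd_balancing (Suc k)" 2]
    by (simp add: odd_balancing_error_def)
qed

lemma odd_balancing_error_Suc_less:
  "odd_balancing_error (Suc (Suc k)) < odd_balancing_error (Suc k)"
proof -
  let ?x = "odd_balancing (Suc k)" and ?y = "odd_balancing (Suc (Suc k))"
  have x: "1 < ?x" and xy: "?x < ?y"
    using odd_balancing_Suc_ge_33[of k] odd_balancing_less_Suc by simp_all
  have "1 < ?x ^ 2" "?x ^ 2 < ?y ^ 2"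
    using x xy by (simp_all add: one_less_power power_strict_mono)
  then have "?x * (?x ^ 2 - 1) < ?y * (?y ^ 2 - 1)" "0 < ?x * (?x ^ 2 - 1)"
    using x xy by (auto intro!: mult_strict_mono)
  then show ?thesis
    unfolding odd_balancing_error_def by (intro divide_strict_left_mono) auto
qed

lemma odd_balancing_error_le: "odd_balancing_error (Suc k) \<le> 1 / odd_balancing (Suc k)"
proof -
  let ?x = "odd_balancing (Suc k)"
  have x: "33 \<le> ?x"
    by (rule odd_balancing_Suc_ge_33)
  then have "2 \<le> ?x ^ 2"
    using power_mono[of 33 ?x 2] by simp
  then have "?x * 1 \<le> ?x * (?x ^ 2 - 1)"
    using x by (intro mult_left_mono) auto
  then show ?thesis
    unfolding odd_balancing_error_def using x by (intro divide_left_mono) auto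
qed

lemma tendsto_inverse_odd_balancing:
  "(\<lambda>j. 1 / odd_balancing (j + k)) \<longlonglongrightarrow> 0"
  by (rule LIMSEQ_ignore_initial_segment)
    (rule tendsto_divide_0[OF tendsto_const filterlim_at_top_imp_at_infinity[OF filterlim_odd_balancing]])

text \<open>Leibniz criterion: the terms decrease to 0, so the sum lies between its partial sums of
  two terms and of one term. The former is positive by strict decrease.\<close>

lemma odd_balancing_error_alternating:
  obtains s where "(\<lambda>j. (-1) ^ j * odd_balancing_error (Suc (j + k))) sums s"
    and "0 < s" and "s \<le> odd_balancing_error (Suc k)"
proof -
  let ?e = "\<lambda>j. odd_balancing_error (Suc (j + k))"
  have lim: "?e \<longlonglongrightarrow> 0"
    by (rule tendsto_sandwich[OF _ _ tendsto_const tendsto_inverse_odd_balancing[of "Suc k"]])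
      (auto intro!: always_eventually less_imp_le[OF odd_balancing_error_pos] odd_balancing_error_le)
  note leibniz = summable_Leibniz'[of ?e, OF lim less_imp_le[OF odd_balancing_error_pos]]
  have mono: "?e (Suc j) \<le> ?e j" for j
    using odd_balancing_error_Suc_less[of "j + k"] by simp
  show thesis
  proof
    show "(\<lambda>j. (-1) ^ j * ?e j) sums (\<Sum>j. (-1) ^ j * ?e j)"
      using leibniz(1) mono by (blast intro: summable_sums)
    have "?e 0 - ?e 1 \<le> (\<Sum>j. (-1) ^ j * ?e j)"
      using leibniz(2)[OF mono, of 1] by (simp add: numeral_2_eq_2)
    then show "0 < (\<Sum>j. (-1) ^ j * ?e j)"
      using odd_balancing_error_Suc_less[of k] by simp
    show "(\<Sum>j. (-1) ^ j * ?e j) \<le> odd_balancing_error (Suc k)"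
      using leibniz(4)[OF mono, of 0] by simp
  qed
qed

text \<open>The gap on the right is 1 / (D (D + 1)), whose denominator grows only quadratically in
  the larger term, while that of the error is cubic.\<close>

lemma odd_balancing_error_less:
  assumes "D = odd_balancing (Suc k) + odd_balancing k"
  shows "odd_balancing_error (Suc k) < 1 / D - 1 / (D + 1)"
proof -
  let ?x = "odd_balancing (Suc k)"
  have x: "33 \<le> ?x"
    by (rule odd_balancing_Suc_ge_33)
  have D: "0 < D" "D \<le> 2 * ?x"
    using assms odd_balancing_less_Suc[of k] odd_balancing_ge_1[of k] x by simp_all
  have "D * (D + 1) \<le> (2 * ?x) * (2 * ?x + 1)"
    using D by (intro mult_mono) auto
  also have "\<dots> = ?x * (4 * ?x + 2)"
    by (simp add: algebra_simps)
  also have "\<dots> < ?x * (?x ^ 2 - 1)"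
  proof (intro mult_strict_left_mono)
    have "33 * ?x \<le> ?x ^ 2"
      using x by (simp add: power2_eq_square)
    then show "4 * ?x + 2 < ?x ^ 2 - 1"
      using x by linarith
  qed (use x in simp)
  finally have "D * (D + 1) < ?x * (?x ^ 2 - 1)" .
  moreover have "0 < D * (D + 1)"
    using D by simp
  ultimately have "odd_balancing_error (Suc k) < 1 / (D * (D + 1))"
    unfolding odd_balancing_error_def by (intro divide_strict_left_mono) auto
  also have "\<dots> = 1 / D - 1 / (D + 1)"
    using D by (simp add: field_simps)
  finally show ?thesis .
qed

lemma alternating_reciprocal_sum:
  obtains T where "(\<lambda>j. (-1) ^ j / odd_balancing (Suc (j + k))) sums T"
    and "1 / (odd_balancing (Suc k) + odd_balancing k + 1) < T"
    and "T < 1 / (odd_balancing (Suc k) + odd_balancing k)"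
proof -
  let ?D = "\<lambda>j. odd_balancing (Suc (j + k)) + odd_balancing (j + k)"
  let ?a = "\<lambda>j. (-1) ^ j / ?D j"
  let ?e = "\<lambda>j. (-1) ^ j * odd_balancing_error (Suc (j + k))"
  obtain s where s: "?e sums s" "0 < s" "s \<le> odd_balancing_error (Suc k)"
    by (rule odd_balancing_error_alternating)
  have "?a \<longlonglongrightarrow> 0"
  proof (rule tendsto_0_le[OF tendsto_inverse_odd_balancing[of k], where K = 1])
    have "norm (?a j) \<le> norm (1 / odd_balancing (j + k)) * 1" for j
      using odd_balancing_ge_1[of "j + k"] odd_balancing_ge_1[of "Suc (j + k)"]
      by (simp add: norm_divide norm_power frac_le)
    then show "\<forall>\<^sub>F j in sequentially. norm (?a j) \<le> norm (1 / odd_balancing (j + k)) * 1"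
      by (blast intro: always_eventually)
  qed
  \<comment> \<open>Neighbouring signs differ, so each difference is a signed sum of two
    reciprocals, as in \<open>reciprocal_pair_sum\<close>.\<close>
  then have "(\<lambda>j. ?a j - ?a (Suc j)) sums (?a 0 - 0)"
    by (rule telescope_sums')
  from sums_diff[OF this s(1)]
  have "(\<lambda>j. ?a j - ?a (Suc j) - ?e j) sums (1 / ?D 0 - s)"
    by simp
  moreover have "?a j - ?a (Suc j) - ?e j = (-1) ^ j / odd_balancing (Suc (j + k))" for j
  proof -
    have "?a j - ?a (Suc j) - ?e j =
      (-1) ^ j * (1 / ?D j + 1 / ?D (Suc j) - odd_balancing_error (Suc (j + k)))"
      by (simp add: algebra_simps)
    also have "\<dots> = (-1) ^ j * (1 / odd_balancing (Suc (j + k)))"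
      using reciprocal_pair_sum[of "j + k"] by simp
    finally show ?thesis by simp
  qed
  ultimately have "(\<lambda>j. (-1) ^ j / odd_balancing (Suc (j + k))) sums (1 / ?D 0 - s)"
    by simp
  \<comment> \<open>\<open>0 < s\<close> gives the upper bound; \<open>s\<close> being at most the
    first error, hence below the gap, gives the lower one.\<close>
  then show thesis
    by (rule that) (use s odd_balancing_error_less[OF refl, of k] in simp_all)
qed

theorem theorem8:
  fixes n :: nat
  assumes "n \<ge> 1"
  shows "\<lfloor>inverse (\<Sum>j. (-1) ^ (n + j) / real_of_int (balancing (2 * (n + j) + 1)))\<rfloor> =
    (if even n then balancing (2 * n + 1) + balancing (2 * n - 1)
     else - (balancing (2 * n + 1) + balancing (2 * n - 1) + 1))"
proof -
  \<comment> \<open>This turns the truncated subtraction \<open>2 * n - 1\<close> into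
    \<open>2 * k + 1\<close>.\<close>
  obtain k where n: "n = Suc k"
    using assms by (cases n) auto
  define D where "D = balancing (2 * n + 1) + balancing (2 * n - 1)"
  have D: "real_of_int D = odd_balancing (Suc k) + odd_balancing k"
    by (simp add: D_def n odd_balancing_def del: balancing.simps)
  then have Dpos: "0 < real_of_int D"
    using odd_balancing_ge_1[of k] odd_balancing_ge_1[of "Suc k"] by linarith
  obtain T where T: "(\<lambda>j. (-1) ^ j / odd_balancing (Suc (j + k))) sums T"
    and lower: "1 / (real_of_int D + 1) < T" and upper: "T < 1 / real_of_int D"
    using alternating_reciprocal_sum[of k] unfolding D by metis
  have "0 < T"
    using lower Dpos by (smt (verit) divide_pos_pos)
  with lower upper Dpos have inv: "D < inverse T" "inverse T < D + 1"
    by (simp_all add: field_simps)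
  have "(\<lambda>j. (-1) ^ n * ((-1) ^ j / odd_balancing (Suc (j + k)))) sums ((-1) ^ n * T)"
    using T by (rule sums_mult)
  also have "(\<lambda>j. (-1) ^ n * ((-1) ^ j / odd_balancing (Suc (j + k)))) =
      (\<lambda>j. (-1) ^ (n + j) / real_of_int (balancing (2 * (n + j) + 1)))"
    by (simp add: n odd_balancing_def power_add mult.commute add.commute del: balancing.simps)
  finally have sum: "(\<Sum>j. (-1) ^ (n + j) / real_of_int (balancing (2 * (n + j) + 1)))
      = (-1) ^ n * T"
    by (rule sums_unique[symmetric])
  \<comment> \<open>Even \<open>n\<close> needs the strict upper bound on \<open>inverse T\<close>;
    for odd \<open>n\<close> negation swaps the ends, so the strict lower bound is needed.\<close>
  have "\<lfloor>inverse ((-1) ^ n * T)\<rfloor> = (if even n then D else - (D + 1))"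
    using inv by (auto simp: floor_eq_iff)
  then show ?thesis
    unfolding sum D_def .
qed

end
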